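(* Let $f:\mathbb{R}^n\to\mathbb{R}\cup\{\infty\}$ be continuously differentiable, let $g$ be a sharp-peak function with constant $c>0$, let $\varphi(\mathbf{x})=\sum_{i=1}^n g(x_i)$, let $\mathbb{B}=[0,1]^n$, and let $\mu>\overline{\mu}:=\max_{\mathbf{x}\in\mathbb{B}}\|\nabla f(\mathbf{x})\|_\infty/c$. A point is a global minimizer of the problem $$\min_{\mathbf{x}\in\mathbb{R}^n} f(\mathbf{x})\quad\text{s.t.}\quad g(x_i)=0,\ 0\leq x_i\leq 1,\ i=1,\dots,n,$$ if and only if it is a global minimizer of the problem $$\min_{\mathbf{x}\in\mathbb{B}}\ f(\mathbf{x})+\mu\varphi(\mathbf{x}).$$
   Context: Let $B=[0,1]$. $\partial$ denotes the limiting subdifferential (Rockafellar–Wets, Definition 8.3), $N_{B}(\cdot)$ the normal cone of $B$, and $\delta_B$ the indicator function of $B$ ($0$ on $B$, $+\infty$ off $B$). Sharp-peak function (SPF): $g:\mathbb{R}\to\mathbb{R}\cup\{\infty\}$ is an SPF if (c1) for any $x\in B$, $g(x)\geq 0$, and $g(x)=0$ if and only if $x\in\{0,1\}$; (c2) $g$ is lower semi-continuous on $B$ and there is a constant $c>0$ with $|\nu|\geq c$ for all $\nu\in\partial g(x)$ and all $x\in B$ ($\partial g(x)=\emptyset$ is allowed); (c3) $\partial(g+\delta_B)(x)=\partial g(x)+N_B(x)$ for any $x\in\{0,1\}$. The constant $c$ in the definition of $\overline{\mu}$ is the constant from (c2). *)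

theory Defs
  imports "HOL-Analysis.Analysis"
begin

section \<open>Variational analysis (Rockafellar--Wets, Definitions 1.5, 6.3 and 8.3)\<close>

text \<open>
  The difference quotient has a finite subtrahend \<open>f x\<close>, so no undefined expression \<open>\<infinity> - \<infinity>\<close>
  occurs. There are no subgradients where \<open>f\<close> is infinite.
\<close>

definition regular_subdifferential :: "('a::euclidean_space \<Rightarrow> ereal) \<Rightarrow> 'a \<Rightarrow> 'a set" where
  "regular_subdifferential f x =
     {v. \<bar>f x\<bar> \<noteq> \<infinity> \<and>
         0 \<le> Liminf (at x) (\<lambda>y. (f y - f x - ereal (v \<bullet> (y - x))) / ereal (norm (y - x)))}"

definition limiting_subdifferential :: "('a::euclidean_space \<Rightarrow> ereal) \<Rightarrow> 'a \<Rightarrow> 'a set" where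
  "limiting_subdifferential f x =
     {v. \<bar>f x\<bar> \<noteq> \<infinity> \<and>
         (\<exists>xs vs. xs \<longlonglongrightarrow> x \<and> (\<lambda>k. f (xs k)) \<longlonglongrightarrow> f x \<and>
                  (\<forall>k. vs k \<in> regular_subdifferential f (xs k)) \<and> vs \<longlonglongrightarrow> v)}"

definition regular_normal_cone :: "'a::euclidean_space set \<Rightarrow> 'a \<Rightarrow> 'a set" where
  "regular_normal_cone C x =
     {v. x \<in> C \<and> Limsup (at x within C) (\<lambda>y. ereal (v \<bullet> (y - x) / norm (y - x))) \<le> 0}"

definition normal_cone :: "'a::euclidean_space set \<Rightarrow> 'a \<Rightarrow> 'a set" where
  "normal_cone C x =
     {v. x \<in> C \<and>
         (\<exists>xs vs. (\<forall>k. xs k \<in> C \<and> vs k \<in> regular_normal_cone C (xs k)) \<and>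
                  xs \<longlonglongrightarrow> x \<and> vs \<longlonglongrightarrow> v)}"

definition indicator_fun :: "'a set \<Rightarrow> 'a \<Rightarrow> ereal" where
  "indicator_fun C x = (if x \<in> C then 0 else \<infinity>)"

definition lsc_on :: "'a::topological_space set \<Rightarrow> ('a \<Rightarrow> ereal) \<Rightarrow> bool" where
  "lsc_on S f \<longleftrightarrow> (\<forall>x\<in>S. f x \<le> Liminf (at x within S) f)"


section \<open>Smoothness of extended-real-valued functions\<close>

text \<open>
  Since \<^const>\<open>real_of_ereal\<close> sends infinite values to \<open>0\<close>, finiteness near \<open>x\<close> has to be
  required separately.
\<close>

definition has_gradient :: "('a::real_inner \<Rightarrow> ereal) \<Rightarrow> 'a \<Rightarrow> 'a \<Rightarrow> bool" where
  "has_gradient f x v \<longleftrightarrow>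
     (\<forall>\<^sub>F y in nhds x. \<bar>f y\<bar> \<noteq> \<infinity>) \<and> GDERIV (\<lambda>y. real_of_ereal (f y)) x :> v"

definition gradient :: "('a::real_inner \<Rightarrow> ereal) \<Rightarrow> 'a \<Rightarrow> 'a" where
  "gradient f x = (THE v. has_gradient f x v)"

definition continuously_differentiable_on :: "'a::real_inner set \<Rightarrow> ('a \<Rightarrow> ereal) \<Rightarrow> bool" where
  "continuously_differentiable_on U f \<longleftrightarrow>
     (\<forall>x\<in>U. \<exists>v. has_gradient f x v) \<and> continuous_on U (gradient f)"


section \<open>Sharp-peak functions and the penalty problem\<close>

definition sharp_peak :: "(real \<Rightarrow> ereal) \<Rightarrow> real \<Rightarrow> bool" where
  "sharp_peak g c \<longleftrightarrow>
     (\<forall>x. g x \<noteq> -\<infinity>) \<and>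
     (\<forall>x\<in>{0..1}. g x \<ge> 0 \<and> (g x = 0 \<longleftrightarrow> x \<in> {0, 1})) \<and>
     lsc_on {0..1} g \<and>
     c > 0 \<and> (\<forall>x\<in>{0..1}. \<forall>v\<in>limiting_subdifferential g x. \<bar>v\<bar> \<ge> c) \<and>
     (\<forall>x\<in>{0, 1}. limiting_subdifferential (\<lambda>t. g t + indicator_fun {0..1} t) x =
                  limiting_subdifferential g x + normal_cone {0..1} x)"

definition penalty :: "(real \<Rightarrow> ereal) \<Rightarrow> real ^ 'n \<Rightarrow> ereal" where
  "penalty g x = (\<Sum>i\<in>UNIV. g (x $ i))"

text \<open>The box \<open>[0,1]\<^sup>n\<close> is \<^term>\<open>cbox 0 1 :: (real ^ 'n) set\<close>.\<close>

definition penalty_threshold :: "(real ^ 'n \<Rightarrow> ereal) \<Rightarrow> real \<Rightarrow> real" where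
  "penalty_threshold f c = (SUP x\<in>cbox 0 1. infnorm (gradient f x)) / c"

text \<open>Under the smoothness assumption the supremum is a maximum.\<close>

lemma penalty_threshold_attained:
  fixes f :: "real ^ 'n \<Rightarrow> ereal"
  assumes "continuously_differentiable_on U f" and "cbox 0 1 \<subseteq> U"
  obtains x where "x \<in> cbox 0 1" and "penalty_threshold f c = infnorm (gradient f x) / c"
    and "\<And>y. y \<in> cbox 0 1 \<Longrightarrow> infnorm (gradient f y) \<le> infnorm (gradient f x)"
proof -
  have "continuous_on (cbox 0 1) (\<lambda>x. infnorm (gradient f x))"
    using assms continuous_on_subset
    by (auto simp: continuously_differentiable_on_def intro!: continuous_on_infnorm)
  moreover have "(0 :: real ^ 'n) \<in> cbox 0 1"
    by (simp add: mem_box_cart)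
  ultimately obtain x where x: "x \<in> cbox 0 1"
    and max: "\<And>y. y \<in> cbox 0 1 \<Longrightarrow> infnorm (gradient f y) \<le> infnorm (gradient f x)"
    using continuous_attains_sup[OF compact_cbox] by (metis empty_iff)
  have "(SUP x\<in>cbox 0 1. infnorm (gradient f x)) = infnorm (gradient f x)"
    using x max by (intro cSup_eq_maximum) auto
  then have "penalty_threshold f c = infnorm (gradient f x) / c"
    by (simp only: penalty_threshold_def)
  with x show thesis
    using max by (rule that)
qed

end

theory Submission
  imports Defs
begin

text \<open>
  The feasible points of the constrained problem are the vertices of the box, and there the penalty
  vanishes, so both objectives agree on them. It therefore suffices that every point \<open>y\<close> of the box
  that is not a vertex is strictly worse, for the penalized objective, than some vertex: then the
  penalized minimizers are vertices, and a vertex that is best among the vertices is best in the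
  whole box.

  If the penalty of \<open>y\<close> is infinite, any vertex will do. Otherwise the non-integral coordinates are
  rounded one at a time (\<open>round_coordinate\<close>, \<open>round_to_vertex\<close>), because \<open>\<phi>\<close> is a sum over the
  coordinates. Varying only coordinate \<open>i\<close>, and dividing by \<open>\<mu> > 0\<close>, leaves the one-dimensional
  function \<open>u + g\<close> on \<open>[0,1]\<close>, up to a constant, where \<open>u' = \<partial>\<^sub>i f / \<mu>\<close>. It is lower semicontinuous,
  hence has a minimizer (\<open>lsc_on_attains_inf\<close>). At a minimizer \<open>s\<close> inside \<open>(0,1)\<close>, Fermat's rule gives
  \<open>- u' s \<in> \<partial>g(s)\<close> (\<open>regular_subgradient_at_local_min\<close>), so \<open>\<bar>u' s\<bar> \<ge> c\<close>; but \<open>\<mu>\<close> above the threshold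
  means \<open>\<bar>u'\<bar> < c\<close>. So the minimum is attained only at \<open>0\<close> or \<open>1\<close>, and moving coordinate \<open>i\<close> to
  a minimizing endpoint strictly lowers the objective (\<open>sharp_peak_endpoint_below\<close>).
\<close>

section \<open>Lower semicontinuous functions\<close>

text \<open>
  If no point were a minimizer, each \<open>x\<close> would have a witness \<open>w x\<close> with a smaller value, and by
  lower semicontinuity \<open>w x\<close> beats a whole neighbourhood of \<open>x\<close>. By compactness finitely many
  witnesses beat everything in \<open>S\<close>, including the best of themselves.
\<close>

lemma lsc_on_attains_inf:
  assumes "compact S" and "S \<noteq> {}" and lsc: "lsc_on S h"
  obtains x where "x \<in> S" and "\<And>y. y \<in> S \<Longrightarrow> h x \<le> h y"
proof -
  have "\<exists>x\<in>S. \<forall>y\<in>S. h x \<le> h y"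
  proof (rule ccontr)
    assume "\<not> ?thesis"
    then have "\<forall>x\<in>S. \<exists>y\<in>S. h y < h x"
      by (metis not_le)
    then obtain w where w: "\<And>x. x \<in> S \<Longrightarrow> w x \<in> S" "\<And>x. x \<in> S \<Longrightarrow> h (w x) < h x"
      by metis
    have "\<exists>T. open T \<and> x \<in> T \<and> (\<forall>z\<in>T \<inter> S. h (w x) < h z)" if "x \<in> S" for x
    proof -
      have "\<forall>\<^sub>F z in at x within S. h (w x) < h z"
        using lsc that w(2)[OF that] by (auto simp: lsc_on_def le_Liminf_iff)
      then show ?thesis
        using w(2)[OF that] unfolding eventually_at_topological by (metis IntE)
    qed
    then obtain T where T: "\<And>x. x \<in> S \<Longrightarrow> open (T x)" "\<And>x. x \<in> S \<Longrightarrow> x \<in> T x"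
      "\<And>x z. x \<in> S \<Longrightarrow> z \<in> T x \<Longrightarrow> z \<in> S \<Longrightarrow> h (w x) < h z"
      by (metis IntI)
    have "S \<subseteq> (\<Union>x\<in>S. T x)"
      using T(2) by blast
    then obtain C where C: "C \<subseteq> S" "finite C" "S \<subseteq> (\<Union>x\<in>C. T x)"
      using compactE_image[OF \<open>compact S\<close>, of S T] T(1) by blast
    with \<open>S \<noteq> {}\<close> have "C \<noteq> {}"
      by blast
    with \<open>finite C\<close> obtain m where m: "m \<in> C" "\<And>x. x \<in> C \<Longrightarrow> h (w m) \<le> h (w x)"
      using arg_min_if_finite[of C "h \<circ> w"] by (metis comp_apply not_le)
    have "w m \<in> S"
      using C(1) m(1) w(1) by blast
    with C(3) obtain x where "x \<in> C" "w m \<in> T x"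
      by blast
    with T(3)[of x "w m"] C(1) \<open>w m \<in> S\<close> m(2) show False
      by (meson not_le subsetD)
  qed
  with that show thesis
    by blast
qed

lemma lsc_on_add_continuous:
  fixes u :: "'a::topological_space \<Rightarrow> real"
  assumes "continuous_on S u" and "lsc_on S g"
  shows "lsc_on S (\<lambda>y. ereal (u y) + g y)"
  unfolding lsc_on_def le_Liminf_iff
proof (intro ballI allI impI)
  fix x a
  assume x: "x \<in> S" and a: "a < ereal (u x) + g x"
  have "a - ereal (u x) < g x"
    using a by (cases a; cases "g x") auto
  \<comment> \<open>The slack in \<open>a < u x + g x\<close> is shared out: \<open>b\<close> stays below \<open>g x\<close> and \<open>e\<close> below \<open>u x\<close>.\<close>
  then obtain b where b: "a < ereal (b + u x)" "ereal b < g x"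
  proof (rule ereal_dense2[THEN exE])
    fix b assume "a - ereal (u x) < ereal b \<and> ereal b < g x"
    then show thesis
      using that[of b] by (cases a) auto
  qed
  obtain e where e: "a < ereal (b + e)" "e < u x"
  proof (cases a)
    case (real r)
    then show thesis
      using b(1) that[of "(r - b + u x) / 2"] by (auto simp: field_simps)
  next
    case PInf
    with b(1) show thesis by simp
  next
    case MInf
    then show thesis
      using that[of "u x - 1"] by simp
  qed
  have "\<forall>\<^sub>F y in at x within S. e < u y"
    using assms(1) x e(2) by (auto simp: continuous_on_def intro: order_tendstoD)
  moreover have "\<forall>\<^sub>F y in at x within S. ereal b < g y"
    using assms(2) x b(2) by (auto simp: lsc_on_def le_Liminf_iff)
  ultimately show "\<forall>\<^sub>F y in at x within S. a < ereal (u y) + g y"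
  proof eventually_elim
    case (elim y)
    have "ereal (b + e) \<le> ereal (u y) + g y"
      using elim by (cases "g y") auto
    with e(1) show ?case by (rule less_le_trans)
  qed
qed

section \<open>Fermat's rule\<close>

text \<open>
  Minimality bounds \<open>g y - g x\<close> below by \<open>u x - u y\<close>, and differentiability of \<open>u\<close> says that this
  is \<open>- D \<bullet> (y - x) + o(norm (y - x))\<close>.
\<close>

lemma regular_subgradient_at_local_min:
  fixes u :: "'a::euclidean_space \<Rightarrow> real"
  assumes u: "GDERIV u x :> D" and fin: "\<bar>g x\<bar> \<noteq> \<infinity>"
    and min: "\<forall>\<^sub>F y in at x. ereal (u x) + g x \<le> ereal (u y) + g y"
  shows "- D \<in> regular_subdifferential g x"
proof -
  let ?r = "\<lambda>y. (u y - u x - (y - x) \<bullet> D) / norm (y - x)"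
  obtain G where G: "g x = ereal G"
    using fin by (cases "g x") auto
  have "(?r \<longlongrightarrow> 0) (at x)"
    using u unfolding gderiv_def has_derivative_iff_norm
    by (subst tendsto_norm_zero_iff[symmetric]) (simp add: norm_divide)
  then have lim: "((\<lambda>y. ereal (- ?r y)) \<longlongrightarrow> 0) (at x)"
    using tendsto_minus[of ?r 0 "at x"] by (simp add: zero_ereal_def)
  have "0 = Liminf (at x) (\<lambda>y. ereal (- ?r y))"
    using lim_imp_Liminf[OF _ lim] by simp
  also have "\<dots> \<le> Liminf (at x) (\<lambda>y. (g y - g x - ereal (- D \<bullet> (y - x))) / ereal (norm (y - x)))"
  proof (rule Liminf_mono)
    show "\<forall>\<^sub>F y in at x. ereal (- ?r y)
            \<le> (g y - g x - ereal (- D \<bullet> (y - x))) / ereal (norm (y - x))"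
      using min eventually_neq_at_within[of x]
    proof eventually_elim
      case (elim y)
      then have pos: "norm (y - x) > 0" by simp
      show ?case
      proof (cases "g y")
        case (real q)
        then show ?thesis
          using elim pos G by (simp add: inner_commute divide_simps)
      qed (use elim pos G in auto)
    qed
  qed
  finally show ?thesis
    using fin by (simp add: regular_subdifferential_def)
qed

lemma regular_subset_limiting:
  "regular_subdifferential f x \<subseteq> limiting_subdifferential f x"
proof
  fix v assume "v \<in> regular_subdifferential f x"
  then show "v \<in> limiting_subdifferential f x"
    unfolding limiting_subdifferential_def
    by (intro CollectI conjI exI[where x = "\<lambda>_. x"] exI[where x = "\<lambda>_. v"])
      (simp_all add: regular_subdifferential_def)
qed

section \<open>Rounding the coordinates\<close>

text \<open>
  A perturbation whose slope stays below \<open>c\<close> cannot balance the slopes of the sharp peak, so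
  \<open>u + g\<close> has no minimizer in the open interval. Hence its minimizers are endpoints, where \<open>g = 0\<close>,
  and interior points are strictly above the minimum.
\<close>

lemma sharp_peak_endpoint_below:
  fixes u u' :: "real \<Rightarrow> real"
  assumes g: "sharp_peak g c" and cont: "continuous_on {0..1} u"
    and deriv: "\<And>s. s \<in> {0<..<1} \<Longrightarrow> (u has_real_derivative u' s) (at s)"
    and small: "\<And>s. s \<in> {0<..<1} \<Longrightarrow> \<bar>u' s\<bar> < c"
    and t: "t \<in> {0<..<1}"
  obtains s where "s \<in> {0, 1}" and "ereal (u s) < ereal (u t) + g t"
proof -
  let ?h = "\<lambda>s. ereal (u s) + g s"
  have vertex: "g s = 0" if "s \<in> {0, 1}" for s
    using g that by (auto simp: sharp_peak_def)
  have interior: False if s: "s \<in> {0<..<1}" and min: "\<And>y. y \<in> {0..1} \<Longrightarrow> ?h s \<le> ?h y" for s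
  proof -
    have "?h s \<le> ?h 0"
      using min by simp
    then have "\<bar>g s\<bar> \<noteq> \<infinity>"
      using g s vertex by (cases "g s") (auto simp: sharp_peak_def)
    moreover have "\<forall>\<^sub>F y in at s. ?h s \<le> ?h y"
      using eventually_at_in_open'[of "{0<..<1}" s] s by (auto elim!: eventually_mono intro!: min)
    ultimately have "- u' s \<in> regular_subdifferential g s"
      using deriv[OF s] by (intro regular_subgradient_at_local_min) simp_all
    then have "- u' s \<in> limiting_subdifferential g s"
      using regular_subset_limiting by blast
    then have "c \<le> \<bar>u' s\<bar>"
      using g s by (force simp: sharp_peak_def)
    with small[OF s] show False
      by simp
  qed
  have "lsc_on {0..1} ?h"
    using g cont by (intro lsc_on_add_continuous) (auto simp: sharp_peak_def)
  then obtain s where s: "s \<in> {0..1}" and min: "\<And>y. y \<in> {0..1} \<Longrightarrow> ?h s \<le> ?h y"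
    using lsc_on_attains_inf[of "{0..1}" ?h] by auto
  have end_pt: "s \<in> {0, 1}"
    using interior[of s] s min by fastforce
  have "?h s < ?h t"
  proof (rule ccontr)
    assume "\<not> ?h s < ?h t"
    then have "?h t \<le> ?h y" if "y \<in> {0..1}" for y
      using min[OF that] by (meson not_le order_trans)
    with interior[OF t] show False by blast
  qed
  with vertex[OF end_pt] have "ereal (u s) < ereal (u t) + g t"
    by simp
  with end_pt show thesis
    by (rule that)
qed

text \<open>
  The description operator that defines \<^const>\<open>gradient\<close> is meaningful because derivatives are unique.
\<close>

lemma has_gradient_gradient:
  assumes "has_gradient f x v"
  shows "has_gradient f x (gradient f x)"
  unfolding gradient_def
proof (rule theI[where P = "has_gradient f x", OF assms])
  fix w assume "has_gradient f x w"
  with assms have "(\<lambda>h. h \<bullet> w) = (\<lambda>h. h \<bullet> v)"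
    unfolding has_gradient_def gderiv_def by (auto intro: has_derivative_unique)
  then show "w = v"
    by (metis vector_eq_ldot)
qed

lemma gradient_component_le_threshold:
  fixes f :: "real ^ 'n \<Rightarrow> ereal"
  assumes "continuously_differentiable_on U f" and "cbox 0 1 \<subseteq> U"
    and "c > 0" and "w \<in> cbox 0 1"
  shows "\<bar>gradient f w $ i\<bar> \<le> c * penalty_threshold f c"
proof -
  obtain z where z: "penalty_threshold f c = infnorm (gradient f z) / c"
    "\<And>y. y \<in> cbox 0 1 \<Longrightarrow> infnorm (gradient f y) \<le> infnorm (gradient f z)"
    using penalty_threshold_attained[OF assms(1,2)] by metis
  have "\<bar>gradient f w $ i\<bar> \<le> infnorm (gradient f z)"
    using component_le_infnorm_cart z(2)[OF assms(4)] by (rule order_trans)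
  with z(1) \<open>c > 0\<close> show ?thesis
    by simp
qed

lemma penalty_parameter_pos:
  fixes f :: "real ^ 'n \<Rightarrow> ereal"
  assumes "continuously_differentiable_on U f" and "cbox 0 1 \<subseteq> U"
    and "c > 0" and "\<mu> > penalty_threshold f c"
  shows "\<mu> > 0"
proof -
  have "(0 :: real ^ 'n) \<in> cbox 0 1"
    by (simp add: mem_box_cart)
  then have "0 \<le> c * penalty_threshold f c"
    using gradient_component_le_threshold[OF assms(1-3)] abs_ge_zero order_trans by metis
  with assms(3,4) show ?thesis
    by (simp add: zero_le_mult_iff)
qed

text \<open>
  Dividing the objective by \<open>\<mu>\<close> gives the smooth part slope at most \<open>\<bar>\<partial>\<^sub>i f\<bar> / \<mu> < c\<close> along coordinate
  \<open>i\<close>, as the one-dimensional comparison requires. Finiteness of the penalty is what makes the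
  decrease strict: an infinite contribution of another coordinate would absorb it. It is also part
  of the conclusion, so that rounding can be repeated.
\<close>

lemma round_coordinate:
  fixes f :: "real ^ 'n \<Rightarrow> ereal" and y :: "real ^ 'n"
  assumes U: "cbox 0 1 \<subseteq> U" and f: "continuously_differentiable_on U f"
    and g: "sharp_peak g c" and \<mu>: "\<mu> > penalty_threshold f c"
    and y: "y \<in> cbox 0 1" and fin: "penalty g y \<noteq> \<infinity>" and i: "y $ i \<notin> {0, 1}"
  obtains s where "s \<in> {0, 1}"
    and "f (\<chi> j. if j = i then s else y $ j) + ereal \<mu> * penalty g (\<chi> j. if j = i then s else y $ j)
         < f y + ereal \<mu> * penalty g y"
    and "penalty g (\<chi> j. if j = i then s else y $ j) \<noteq> \<infinity>"
proof -
  let ?p = "\<lambda>s. \<chi> j. if j = i then s else y $ j"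
  have c: "c > 0"
    using g by (simp add: sharp_peak_def)
  have yi: "y $ i \<in> {0<..<1}"
    using y i by (force simp: mem_box_cart less_le)
  have box: "?p s \<in> cbox 0 1" if "s \<in> {0..1}" for s
    using y that by (auto simp: mem_box_cart)
  have grad: "has_gradient f z (gradient f z)" if "z \<in> cbox 0 1" for z
    using f U that has_gradient_gradient unfolding continuously_differentiable_on_def by blast
  have f_fin: "f z = ereal (real_of_ereal (f z))" if "z \<in> cbox 0 1" for z
    using grad[OF that] unfolding has_gradient_def
    by (metis eventually_nhds_x_imp_x ereal_real')
  have \<mu>_pos: "\<mu> > 0"
    using penalty_parameter_pos[OF f U c \<mu>] .
  have small: "\<bar>gradient f w $ i / \<mu>\<bar> < c" if "w \<in> cbox 0 1" for w
  proof -
    have "\<bar>gradient f w $ i\<bar> \<le> c * penalty_threshold f c"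
      using gradient_component_le_threshold[OF f U c that] .
    also have "\<dots> < c * \<mu>"
      using \<mu> c by simp
    finally show ?thesis
      using \<mu>_pos by (simp add: field_simps)
  qed
  define u where "u = (\<lambda>s. real_of_ereal (f (?p s)) / \<mu>)"
  have p_eq: "?p s = y + (s - y $ i) *\<^sub>R axis i 1" for s
    by (auto simp: vec_eq_iff axis_def)
  have p_deriv: "(?p has_derivative (\<lambda>h. h *\<^sub>R axis i 1)) (at s)" for s
    unfolding p_eq by (auto intro!: derivative_eq_intros)
  have u_deriv: "(u has_real_derivative gradient f (?p s) $ i / \<mu>) (at s)" if "s \<in> {0..1}" for s
  proof -
    have "((\<lambda>z. real_of_ereal (f z)) has_derivative (\<lambda>h. h \<bullet> gradient f (?p s))) (at (?p s))"
      using grad[OF box[OF that]] by (simp add: has_gradient_def gderiv_def)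
    from has_derivative_compose[OF p_deriv this]
    have "((\<lambda>s. real_of_ereal (f (?p s))) has_real_derivative gradient f (?p s) $ i) (at s)"
      by (simp add: has_field_derivative_def inner_axis' mult_commute_abs)
    then show ?thesis
      unfolding u_def by (rule DERIV_cdivide)
  qed
  have "continuous_on {0..1} u"
    using u_deriv by (meson DERIV_isCont continuous_at_imp_continuous_on)
  then obtain s where s: "s \<in> {0, 1}" and less: "ereal (u s) < ereal (u (y $ i)) + g (y $ i)"
    using sharp_peak_endpoint_below[OF g _ u_deriv small[OF box] yi] by auto
  \<comment> \<open>\<open>R\<close> is the part of the penalty that does not change; it is finite, so it cancels.\<close>
  define R where "R = (\<Sum>j\<in>UNIV - {i}. g (y $ j))"
  have pen: "penalty g (?p t) = g t + R" for t
    unfolding penalty_def R_def by (subst sum.remove[of _ i]) (auto intro!: sum.cong)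
  have p_id: "?p (y $ i) = y"
    by (auto simp: vec_eq_iff)
  have nonneg: "g (y $ j) \<ge> 0" for j
    using g y by (auto simp: sharp_peak_def mem_box_cart)
  then have R0: "R \<ge> 0"
    unfolding R_def by (intro sum_nonneg)
  have pen_y: "penalty g y = g (y $ i) + R"
    using pen[of "y $ i"] p_id by simp
  obtain r where r: "R = ereal r"
    using fin R0 nonneg[of i] pen_y by (cases R; cases "g (y $ i)") auto
  obtain q where q: "g (y $ i) = ereal q"
    using fin nonneg[of i] pen_y r by (cases "g (y $ i)") auto
  have gs: "g s = 0"
    using g s by (auto simp: sharp_peak_def)
  have "s \<in> {0..1}"
    using s by auto
  then obtain a b where a: "f (?p s) = ereal a" and b: "f y = ereal b"
    using f_fin[OF box] f_fin[OF y] by metis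
  have "a < b + \<mu> * q"
    using less \<mu>_pos q p_id a b by (simp add: u_def field_simps)
  then have "f (?p s) + ereal \<mu> * penalty g (?p s) < f y + ereal \<mu> * penalty g y"
    using pen[of s] gs pen_y r q a b by (simp add: algebra_simps)
  moreover have "penalty g (?p s) \<noteq> \<infinity>"
    using pen[of s] gs r by simp
  ultimately show thesis
    using s that by blast
qed

lemma round_to_vertex:
  fixes f :: "real ^ 'n \<Rightarrow> ereal" and y :: "real ^ 'n"
  assumes "cbox 0 1 \<subseteq> U" and "continuously_differentiable_on U f"
    and "sharp_peak g c" and "\<mu> > penalty_threshold f c"
    and "y \<in> cbox 0 1" and "penalty g y \<noteq> \<infinity>" and "\<not> (\<forall>i. y $ i \<in> {0, 1})"
  shows "\<exists>z. (\<forall>i. z $ i \<in> {0, 1}) \<and>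
             f z + ereal \<mu> * penalty g z < f y + ereal \<mu> * penalty g y"
  using assms(5-7)
proof (induction "card {i. y $ i \<notin> {0, 1}}" arbitrary: y rule: less_induct)
  case less
  then obtain i where i: "y $ i \<notin> {0, 1}"
    by blast
  from round_coordinate[OF assms(1-4) less.prems(1,2) i]
  obtain s where s: "s \<in> {0, 1}"
    and lt: "f (\<chi> j. if j = i then s else y $ j) +
             ereal \<mu> * penalty g (\<chi> j. if j = i then s else y $ j)
             < f y + ereal \<mu> * penalty g y"
    and fin: "penalty g (\<chi> j. if j = i then s else y $ j) \<noteq> \<infinity>"
    by blast
  define y' where "y' = (\<chi> j. if j = i then s else y $ j)"
  show ?case
  proof (cases "\<forall>i. y' $ i \<in> {0, 1}")
    case True
    with lt show ?thesis
      unfolding y'_def by blast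
  next
    case False
    have "{j. y' $ j \<notin> {0, 1}} \<subset> {j. y $ j \<notin> {0, 1}}"
      using i s by (auto simp: y'_def split: if_splits)
    then have "card {j. y' $ j \<notin> {0, 1}} < card {j. y $ j \<notin> {0, 1}}"
      by (intro psubset_card_mono) auto
    moreover have "y' \<in> cbox 0 1"
      using less.prems(1) s by (auto simp: y'_def mem_box_cart)
    moreover have "penalty g y' \<noteq> \<infinity>"
      using fin by (simp add: y'_def)
    ultimately obtain z where "\<forall>i. z $ i \<in> {0, 1}"
      "f z + ereal \<mu> * penalty g z < f y' + ereal \<mu> * penalty g y'"
      using less.hyps False by blast
    with lt show ?thesis
      unfolding y'_def by (meson less_trans)
  qed
qed

section \<open>Exactness of the penalty\<close>

theorem theorem3p2:
  fixes f :: "real ^ 'n \<Rightarrow> ereal" and g :: "real \<Rightarrow> ereal"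
    and c \<mu> :: real and U :: "(real ^ 'n) set" and x :: "real ^ 'n"
  assumes "\<And>y. f y \<noteq> -\<infinity>"
    and "open U" and "cbox 0 1 \<subseteq> U" and "continuously_differentiable_on U f"
    and "sharp_peak g c"
    and "\<mu> > penalty_threshold f c"
  shows "is_arg_min f (\<lambda>y. \<forall>i. g (y $ i) = 0 \<and> 0 \<le> y $ i \<and> y $ i \<le> 1) x \<longleftrightarrow>
         is_arg_min (\<lambda>y. f y + ereal \<mu> * penalty g y) (\<lambda>y. y \<in> cbox 0 1) x"
proof -
  define F where "F y = f y + ereal \<mu> * penalty g y" for y
  define V where "V y \<longleftrightarrow> (\<forall>i. y $ i \<in> {0, 1})" for y :: "real ^ 'n"
  have "g t = 0 \<and> 0 \<le> t \<and> t \<le> 1 \<longleftrightarrow> t \<in> {0, 1}" for t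
    using assms(5) by (auto simp: sharp_peak_def)
  then have feasible: "(\<forall>i. g (y $ i) = 0 \<and> 0 \<le> y $ i \<and> y $ i \<le> 1) \<longleftrightarrow> V y" for y
    unfolding V_def by metis
  have V_box: "y \<in> cbox 0 1" if "V y" for y
    using that feasible[of y] by (simp add: mem_box_cart)
  have F_V: "F y = f y" if "V y" for y
  proof -
    have "penalty g y = 0"
      using feasible[of y] that by (simp add: penalty_def)
    then show ?thesis by (simp add: F_def)
  qed
  have \<mu>_pos: "\<mu> > 0"
    using penalty_parameter_pos[OF assms(4,3) _ assms(6)] assms(5) by (simp add: sharp_peak_def)
  have better: "\<exists>z. V z \<and> F z < F y" if y: "y \<in> cbox 0 1" "\<not> V y" for y
  proof (cases "penalty g y = \<infinity>")
    case True
    have "V 0"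
      by (simp add: V_def)
    obtain v where "has_gradient f 0 v"
      using assms(3,4) V_box[OF \<open>V 0\<close>] unfolding continuously_differentiable_on_def by blast
    then have "\<bar>f 0\<bar> \<noteq> \<infinity>"
      unfolding has_gradient_def using eventually_nhds_x_imp_x by fastforce
    then have "F 0 < \<infinity>"
      using F_V[OF \<open>V 0\<close>] by auto
    moreover have "F y = \<infinity>"
      using True \<mu>_pos assms(1)[of y] by (simp add: F_def)
    ultimately show ?thesis
      using \<open>V 0\<close> by auto
  next
    case False
    from round_to_vertex[OF assms(3-6) y(1) False] y(2) show ?thesis
      unfolding F_def V_def by blast
  qed
  have "is_arg_min f V x \<longleftrightarrow> is_arg_min F (\<lambda>y. y \<in> cbox 0 1) x"
  proof
    assume min: "is_arg_min f V x"
    then have x: "V x"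
      by (simp add: is_arg_min_def)
    have "F x \<le> F z" if "V z" for z
      using min x that F_V by (simp add: is_arg_min_linorder)
    then have "F x \<le> F y" if "y \<in> cbox 0 1" for y
      using better[OF that] by (meson le_less_trans less_imp_le)
    then show "is_arg_min F (\<lambda>y. y \<in> cbox 0 1) x"
      using V_box[OF x] by (simp add: is_arg_min_linorder)
  next
    assume min: "is_arg_min F (\<lambda>y. y \<in> cbox 0 1) x"
    then have "V x"
      using better[of x] V_box by (auto simp: is_arg_min_def)
    moreover have "f x \<le> f y" if "V y" for y
      using min V_box[OF that] F_V[OF that] F_V[OF \<open>V x\<close>] by (auto simp: is_arg_min_linorder)
    ultimately show "is_arg_min f V x"
      by (simp add: is_arg_min_linorder)
  qed
  then show ?thesis
    by (simp only: feasible F_def[abs_def])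
qed

end
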